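(* Let $\vec{G}$ and $\vec{H}$ be linearly ordered graphs, $u$ a vertex of $\vec{G}$ and $v$ a vertex of $\vec{H}$. The characteristic polynomial of the coalescence $\vec{G}\cdot\vec{H}$ of $\vec{G}$ and $\vec{H}$ at $u$ and $v$ is given by $$\vec{P}_{\vec{G}\cdot\vec{H}}(x)=\vec{P}_{\vec{G}}(x)\vec{P}_{\vec{H}-v}(x)+\vec{P}_{\vec{G}-u}(x)\vec{P}_{\vec{H}\leftrightarrow v}(x)-x\,\vec{P}_{\vec{G}-u}(x)\vec{P}_{\vec{H}-v}(x).$$
   Context: A linearly ordered graph $\vec{G}$ is a finite simple graph whose vertices are labelled $1,\ldots,n$ (the label of $w$ is $l(w)$), with each edge directed from the vertex with the smaller label to the vertex with the larger label. Its skew-adjacency matrix $\vec{A}_{\vec{G}}$ has $(i,j)$ entry $1$ if $i,j$ are adjacent and $i<j$, $-1$ if $i,j$ are adjacent and $i>j$, and $0$ otherwise; $\vec{P}_{\vec{G}}(x)=\det(xI-\vec{A}_{\vec{G}})$ (equal to $1$ for the empty graph). $\vec{G}-u$ is obtained by deleting the vertex $u$ and renumbering the remaining vertices in an order-preserving way. Coalescence: $G\cdot H$ is the graph obtained from the disjoint union of $G$ and $H$ by identifying $u$ with $v$. In $\vec{G}\cdot\vec{H}$, the vertices of $G$ (including the identified vertex $u=v$) are labelled as in $\vec{G}$, and each vertex $w$ of $\vec{H}-v$ is labelled $l(w)+n$, where $n$ is the number of vertices of $\vec{G}$ and $l(w)$ is the label of $w$ in the renumbered graph $\vec{H}-v$;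 edges are directed from smaller to larger label. Promotion: $\vec{H}\leftrightarrow v$ is the linearly ordered graph obtained from $\vec{H}$ by replacing $v$ by a vertex with the same adjacent vertices and label $1$, relabelling every other vertex $w$ with $l(w)<l(v)$ as $l(w)+1$ (other labels are unchanged), and directing edges from smaller to larger label. *)

theory Defs
  imports "Jordan_Normal_Form.Char_Poly"
begin

text \<open>The direction of every edge (from the smaller to the larger label) is determined by
  the labelling, so only the underlying undirected edges are stored.\<close>

record 'a lograph =
  verts :: "'a set"
  edges :: "'a set set"
  label :: "'a \<Rightarrow> nat"

locale linearly_ordered_graph =
  fixes G :: "'a lograph"
  assumes finite_verts: "finite (verts G)"
    and edges_simple: "e \<in> edges G \<Longrightarrow> e \<subseteq> verts G \<and> card e = 2"
    and label_bij: "bij_betw (label G) (verts G) {1..card (verts G)}"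

definition adjacent_labels :: "'a lograph \<Rightarrow> nat \<Rightarrow> nat \<Rightarrow> bool" where
  "adjacent_labels G i j \<longleftrightarrow>
     (\<exists>a\<in>verts G. \<exists>b\<in>verts G. label G a = i \<and> label G b = j \<and> {a, b} \<in> edges G)"

text \<open>Matrices are indexed from 0, labels from 1: row \<open>i\<close> belongs to the vertex with
  label \<open>i + 1\<close>.\<close>

definition skew_adjacency :: "'a lograph \<Rightarrow> int mat" where
  "skew_adjacency G = mat (card (verts G)) (card (verts G))
     (\<lambda>(i, j). if adjacent_labels G (i + 1) (j + 1)
               then if i < j then 1 else if i > j then -1 else 0
               else 0)"

definition skew_char_poly :: "'a lograph \<Rightarrow> int poly" where
  "skew_char_poly G = char_poly (skew_adjacency G)"

definition delete_vertex :: "'a lograph \<Rightarrow> 'a \<Rightarrow> 'a lograph" where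
  "delete_vertex G u =
     \<lparr> verts = verts G - {u},
       edges = {e \<in> edges G. u \<notin> e},
       label = (\<lambda>w. if label G u < label G w then label G w - 1 else label G w) \<rparr>"

text \<open>In the disjoint union the vertices of \<open>G\<close> are tagged \<open>Inl\<close> and those of \<open>H\<close> are
  tagged \<open>Inr\<close>; the identified vertex \<open>u = v\<close> is represented by \<open>Inl u\<close>.\<close>

definition coalescence :: "'a lograph \<Rightarrow> 'a \<Rightarrow> 'b lograph \<Rightarrow> 'b \<Rightarrow> ('a + 'b) lograph" where
  "coalescence G u H v =
     \<lparr> verts = Inl ` verts G \<union> Inr ` (verts H - {v}),
       edges = (\<lambda>e. Inl ` e) ` edges G
             \<union> (\<lambda>e. (\<lambda>w. if w = v then Inl u else Inr w) ` e) ` edges H,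
       label = case_sum (label G)
                 (\<lambda>w. label (delete_vertex H v) w + card (verts G)) \<rparr>"

definition promote :: "'a lograph \<Rightarrow> 'a \<Rightarrow> 'a lograph" where
  "promote H v =
     H \<lparr> label := (\<lambda>w. if w = v then 1
                       else if label H w < label H v then label H w + 1
                       else label H w) \<rparr>"

end

theory Submission
  imports Defs
begin

text \<open>The matrix \<open>x I - A\<close> of a coalescence has one row and column \<open>c\<close>, that of the identified
  vertex, which touches both sides; away from it the vertices of \<open>G\<close> and of \<open>H\<close> do not see each
  other. Write row \<open>c\<close> as its part on the \<open>G\<close> side plus its part on the \<open>H\<close> side minus its diagonal
  entry, which both parts contain. By linearity of the determinant in this row, the
  determinant splits into three determinants, and each of them is block triangular: they are the
  products of the \<open>G\<close> block with the block of \<open>H - v\<close>, of the \<open>H\<close> block with the block of \<open>G - u\<close>,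
  and of the diagonal entry \<open>x\<close> with the blocks of \<open>G - u\<close> and \<open>H - v\<close>. These are the three terms
  of the formula (\<open>set_det_cut_vertex\<close>).

  Promotion enters when the \<open>H\<close> block is identified. In the coalescence the label of the
  identified vertex lies below the labels of all other vertices of \<open>H\<close>, whose order among
  themselves is kept; this is the order that \<open>promote H v\<close> puts on \<open>H\<close>.

  The sum of the Leibniz formula over the permutations of a set makes sense without an
  enumeration of that set. Determinants are therefore indexed by the vertex sets themselves,
  and the entries of \<open>x I - A\<close> by pairs of vertices. Renumbering disappears: only the relative
  order of the labels of adjacent vertices matters, and deletion just restricts the index
  set.\<close>

section \<open>Determinants indexed by finite sets\<close>

definition set_det :: "'a set \<Rightarrow> ('a \<Rightarrow> 'a \<Rightarrow> 'r) \<Rightarrow> 'r :: comm_ring_1" where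
  "set_det S F = (\<Sum>p | p permutes S. of_int (sign p) * (\<Prod>i\<in>S. F i (p i)))"

lemma set_det_cong:
  assumes "\<And>i j. i \<in> S \<Longrightarrow> j \<in> S \<Longrightarrow> F i j = F' i j"
  shows "set_det S F = set_det S F'"
  unfolding set_det_def
proof (rule sum.cong[OF refl])
  fix p assume "p \<in> {p. p permutes S}"
  then have "(\<Prod>i\<in>S. F i (p i)) = (\<Prod>i\<in>S. F' i (p i))"
    by (intro prod.cong) (auto simp: assms permutes_in_image)
  then show "of_int (sign p) * (\<Prod>i\<in>S. F i (p i)) = of_int (sign p) * (\<Prod>i\<in>S. F' i (p i))"
    by simp
qed

lemma set_det_singleton [simp]: "set_det {c} F = F c c"
  by (simp add: set_det_def)

lemma det_mat_eq_set_det: "det (mat n n (\<lambda>(i, j). F i j)) = set_det {0..<n} F"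
proof -
  have "(\<Prod>i = 0..<n. mat n n (\<lambda>(i, j). F i j) $$ (i, p i)) = (\<Prod>i = 0..<n. F i (p i))"
    if "p permutes {0..<n}" for p
    using permutes_in_image[OF that] by (intro prod.cong) auto
  then show ?thesis
    by (simp add: det_def set_det_def)
qed

text \<open>Conjugation by a bijection carries the permutations of one set to those of the other and
  preserves signs.\<close>

lemma set_det_reindex:
  assumes f: "bij_betw f A B" and fin: "finite A"
  shows "set_det B F = set_det A (\<lambda>x y. F (f x) (f y))"
proof -
  have inj: "inj_on f A" and im: "f ` A = B"
    using f by (auto simp: bij_betw_def)
  have bij: "bij_betw (map_permutation A f) {p. p permutes A} {p. p permutes B}"
  proof -
    have "bij_betw (\<lambda>p x. if x \<in> B then f (p (inv_into A f x)) else x)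
            {p. p permutes A} {p. p permutes B}"
      by (rule bij_betw_permutations[OF f])
    then show ?thesis
      by (rule bij_betw_cong[THEN iffD1, rotated])
        (auto simp: fun_eq_iff map_permutation_def restrict_id_def im)
  qed
  have "set_det B F = (\<Sum>p | p permutes A. of_int (sign (map_permutation A f p)) *
          (\<Prod>i\<in>B. F i (map_permutation A f p i)))"
    unfolding set_det_def by (rule sum.reindex_bij_betw[OF bij, symmetric])
  also have "\<dots> = set_det A (\<lambda>x y. F (f x) (f y))"
    unfolding set_det_def
  proof (rule sum.cong[OF refl])
    fix p assume "p \<in> {p. p permutes A}"
    then have p: "p permutes A" by simp
    have "(\<Prod>i\<in>B. F i (map_permutation A f p i))
        = (\<Prod>x\<in>A. F (f x) (map_permutation A f p (f x)))"
      by (rule prod.reindex_bij_betw[OF f, symmetric])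
    also have "\<dots> = (\<Prod>x\<in>A. F (f x) (f (p x)))"
      using inj by (intro prod.cong) (auto simp: map_permutation_apply)
    finally show "of_int (sign (map_permutation A f p)) * (\<Prod>i\<in>B. F i (map_permutation A f p i))
        = of_int (sign p) * (\<Prod>i\<in>A. F (f i) (f (p i)))"
      by (simp add: sign_map_permutation[OF inj p fin])
  qed
  finally show ?thesis .
qed

text \<open>Listing \<open>X\<close> before \<open>Y\<close> turns this into the determinant of a block matrix whose upper right
  block is zero.\<close>

lemma set_det_block_triangular:
  fixes F :: "'a \<Rightarrow> 'a \<Rightarrow> 'r :: idom"
  assumes "finite X" and "finite Y" and disj: "X \<inter> Y = {}"
    and zero: "\<And>x y. x \<in> X \<Longrightarrow> y \<in> Y \<Longrightarrow> F x y = 0"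
  shows "set_det (X \<union> Y) F = set_det X F * set_det Y F"
proof -
  define m k where "m = card X" and "k = card Y"
  obtain f where f: "bij_betw f {0..<m} X"
    using ex_bij_betw_nat_finite[OF \<open>finite X\<close>] unfolding m_def by blast
  obtain g where g: "bij_betw g {0..<k} Y"
    using ex_bij_betw_nat_finite[OF \<open>finite Y\<close>] unfolding k_def by blast
  \<comment> \<open>\<open>h\<close> enumerates \<open>X\<close> by the first \<open>m\<close> indices and \<open>Y\<close> by the following \<open>k\<close>.\<close>
  define h where "h i = (if i < m then f i else g (i - m))" for i
  have fX: "f i \<in> X" if "i < m" for i
    using bij_betwE[OF f] that by auto
  have gY: "g i \<in> Y" if "i < k" for i
    using bij_betwE[OF g] that by auto
  have shift: "bij_betw (\<lambda>i. i - m) {m..<m + k} {0..<k}"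
    by (rule bij_betw_byWitness[where f' = "\<lambda>i. i + m"]) auto
  have "bij_betw h {0..<m} X"
    by (rule bij_betw_cong[THEN iffD1, OF _ f]) (auto simp: h_def)
  moreover have "bij_betw h {m..<m + k} Y"
    by (rule bij_betw_cong[THEN iffD1, OF _ bij_betw_trans[OF shift g]]) (auto simp: h_def)
  ultimately have "bij_betw h ({0..<m} \<union> {m..<m + k}) (X \<union> Y)"
    by (rule bij_betw_combine) (rule disj)
  then have h: "bij_betw h {0..<m + k} (X \<union> Y)"
    by (simp add: ivl_disj_un)
  let ?A = "mat m m (\<lambda>(i, j). F (f i) (f j))"
  let ?C = "mat k m (\<lambda>(i, j). F (g i) (f j))"
  let ?D = "mat k k (\<lambda>(i, j). F (g i) (g j))"
  have "set_det (X \<union> Y) F = det (mat (m + k) (m + k) (\<lambda>(i, j). F (h i) (h j)))"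
    unfolding det_mat_eq_set_det by (rule set_det_reindex[OF h]) simp
  also have "mat (m + k) (m + k) (\<lambda>(i, j). F (h i) (h j)) = four_block_mat ?A (0\<^sub>m m k) ?C ?D"
    by (rule eq_matI) (auto simp: h_def fX gY zero)
  also have "det \<dots> = det ?A * det ?D"
    by (rule det_four_block_mat_upper_right_zero) auto
  also have "det ?A = set_det X F"
    unfolding det_mat_eq_set_det by (rule set_det_reindex[OF f, symmetric]) simp
  also have "det ?D = set_det Y F"
    unfolding det_mat_eq_set_det by (rule set_det_reindex[OF g, symmetric]) simp
  finally show ?thesis .
qed

lemma set_det_add_row:
  assumes "finite S" and "c \<in> S"
  shows "set_det S (F(c := \<lambda>j. r j + s j)) = set_det S (F(c := r)) + set_det S (F(c := s))"
proof -
  have expand: "(\<Prod>i\<in>S. (F(c := t)) i (p i)) = t (p c) * (\<Prod>i\<in>S - {c}. F i (p i))" for t p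
    by (subst prod.remove[OF assms]) (auto intro!: prod.cong)
  show ?thesis
    unfolding set_det_def expand sum.distrib[symmetric]
    by (rule sum.cong) (simp_all add: algebra_simps)
qed

text \<open>If deleting \<open>c\<close> separates \<open>A\<close> from \<open>B\<close>, then \<open>c\<close> is the only index whose row can have entries
  towards both sides. The rows \<open>r\<close> and \<open>s\<close> in the proof are the parts of row \<open>c\<close> towards \<open>A\<close>
  and \<open>B\<close>; both include the diagonal entry, so \<open>r + s\<close> exceeds row \<open>c\<close> by the row \<open>t\<close> that has
  only this entry. With any of \<open>r\<close>, \<open>s\<close>, \<open>t\<close> in place of row \<open>c\<close> the matrix is block
  triangular.\<close>

lemma set_det_cut_vertex:
  fixes F :: "'a \<Rightarrow> 'a \<Rightarrow> 'r :: idom"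
  assumes "finite A" and "finite B" and disj: "A \<inter> B = {}" and c: "c \<notin> A" "c \<notin> B"
    and AB: "\<And>a b. a \<in> A \<Longrightarrow> b \<in> B \<Longrightarrow> F a b = 0"
    and BA: "\<And>a b. a \<in> A \<Longrightarrow> b \<in> B \<Longrightarrow> F b a = 0"
  shows "set_det (insert c (A \<union> B)) F
       = set_det (insert c A) F * set_det B F + set_det A F * set_det (insert c B) F
         - F c c * set_det A F * set_det B F"
proof -
  let ?S = "insert c (A \<union> B)"
  define r where "r j = (if j \<in> insert c A then F c j else 0)" for j
  define s where "s j = (if j \<in> insert c B then F c j else 0)" for j
  define t where "t j = (if j = c then F c j else 0)" for j
  have S1: "?S = insert c A \<union> B" and S2: "?S = insert c B \<union> A" by auto
  have split: "set_det ?S (F(c := r)) + set_det ?S (F(c := s)) = set_det ?S F + set_det ?S (F(c := t))"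
  proof -
    have "set_det ?S (F(c := r)) + set_det ?S (F(c := s)) = set_det ?S (F(c := \<lambda>j. r j + s j))"
      by (rule set_det_add_row[symmetric]) (use assms in auto)
    also have "\<dots> = set_det ?S (F(c := \<lambda>j. F c j + t j))"
      using disj c by (intro set_det_cong) (auto simp: r_def s_def t_def)
    also have "\<dots> = set_det ?S (F(c := F c)) + set_det ?S (F(c := t))"
      by (rule set_det_add_row) (use assms in auto)
    finally show ?thesis by simp
  qed
  have "set_det ?S (F(c := r)) = set_det (insert c A) (F(c := r)) * set_det B (F(c := r))"
    unfolding S1 by (rule set_det_block_triangular) (use assms in \<open>auto simp: r_def\<close>)
  moreover have "set_det (insert c A) (F(c := r)) = set_det (insert c A) F"
    by (rule set_det_cong) (auto simp: r_def)
  moreover have "set_det B (F(c := r)) = set_det B F"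
    by (rule set_det_cong) (use c in auto)
  ultimately have R: "set_det ?S (F(c := r)) = set_det (insert c A) F * set_det B F" by simp
  have "set_det ?S (F(c := s)) = set_det (insert c B) (F(c := s)) * set_det A (F(c := s))"
    unfolding S2 by (rule set_det_block_triangular) (use assms in \<open>auto simp: s_def\<close>)
  moreover have "set_det (insert c B) (F(c := s)) = set_det (insert c B) F"
    by (rule set_det_cong) (auto simp: s_def)
  moreover have "set_det A (F(c := s)) = set_det A F"
    by (rule set_det_cong) (use c in auto)
  ultimately have S: "set_det ?S (F(c := s)) = set_det (insert c B) F * set_det A F" by simp
  have "set_det ?S (F(c := t)) = set_det (insert c A) (F(c := t)) * set_det B (F(c := t))"
    unfolding S1 by (rule set_det_block_triangular) (use assms in \<open>auto simp: t_def\<close>)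
  \<comment> \<open>Row \<open>t\<close> vanishes towards \<open>A\<close> as well, so \<open>c\<close> splits off as a block of its own.\<close>
  moreover have "set_det ({c} \<union> A) (F(c := t)) = set_det {c} (F(c := t)) * set_det A (F(c := t))"
    by (rule set_det_block_triangular) (use assms in \<open>auto simp: t_def\<close>)
  moreover have "set_det A (F(c := t)) = set_det A F"
    by (rule set_det_cong) (use c in auto)
  moreover have "set_det B (F(c := t)) = set_det B F"
    by (rule set_det_cong) (use c in auto)
  ultimately have T: "set_det ?S (F(c := t)) = F c c * set_det A F * set_det B F"
    by (simp add: t_def)
  show ?thesis
    using split unfolding R S T by (simp add: algebra_simps eq_diff_eq)
qed

section \<open>The characteristic polynomial as a determinant over the vertices\<close>

definition arc_sign :: "'a lograph \<Rightarrow> 'a \<Rightarrow> 'a \<Rightarrow> int" where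
  "arc_sign G a b = (if {a, b} \<in> edges G
     then if label G a < label G b then 1 else if label G a > label G b then -1 else 0
     else 0)"

definition char_entry :: "'a lograph \<Rightarrow> 'a \<Rightarrow> 'a \<Rightarrow> int poly" where
  "char_entry G a b = (if a = b then [:0, 1:] else 0) - [:arc_sign G a b:]"

text \<open>The entry depends on the labels only through their order; this is how entries of different
  graphs are compared below.\<close>

lemma char_entry_cong:
  assumes "a = b \<longleftrightarrow> a' = b'" and "{a, b} \<in> edges G \<longleftrightarrow> {a', b'} \<in> edges G'"
    and "label G a < label G b \<longleftrightarrow> label G' a' < label G' b'"
    and "label G b < label G a \<longleftrightarrow> label G' b' < label G' a'"
  shows "char_entry G a b = char_entry G' a' b'"
  using assms by (simp add: char_entry_def arc_sign_def)

lemma char_entry_nonadjacent: "a \<noteq> b \<Longrightarrow> {a, b} \<notin> edges G \<Longrightarrow> char_entry G a b = 0"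
  by (simp add: char_entry_def arc_sign_def)

lemma char_entry_diagonal: "char_entry G a a = [:0, 1:]"
  by (simp add: char_entry_def arc_sign_def)

text \<open>The labels are what matches vertices with matrix indices; reindexing the determinant along
  this bijection leaves them visible only in the signs of the arcs.\<close>

lemma skew_char_poly_eq_set_det:
  assumes fin: "finite (verts G)" and lab: "bij_betw (label G) (verts G) {1..card (verts G)}"
  shows "skew_char_poly G = set_det (verts G) (char_entry G)"
proof -
  let ?n = "card (verts G)"
  define M :: "nat \<Rightarrow> nat \<Rightarrow> int poly" where "M i j = (if i = j then [:0, 1:] else 0) -
    [:if adjacent_labels G (i + 1) (j + 1)
      then if i < j then 1 else if i > j then -1 else 0 else 0:]" for i j
  have "char_poly_matrix (skew_adjacency G) = mat ?n ?n (\<lambda>(i, j). M i j)"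
    by (rule eq_matI) (auto simp: char_poly_matrix_def skew_adjacency_def M_def)
  then have "skew_char_poly G = set_det {0..<?n} M"
    by (simp add: skew_char_poly_def char_poly_def det_mat_eq_set_det)
  also have "\<dots> = set_det (verts G) (\<lambda>a b. M (label G a - 1) (label G b - 1))"
  proof (rule set_det_reindex[OF _ fin])
    have "bij_betw (\<lambda>i. i - 1) {1..?n} {0..<?n}"
      by (rule bij_betw_byWitness[where f' = Suc]) auto
    from bij_betw_trans[OF lab this]
    show "bij_betw (\<lambda>a. label G a - 1) (verts G) {0..<?n}" by (simp add: o_def)
  qed
  also have "\<dots> = set_det (verts G) (char_entry G)"
  proof (rule set_det_cong)
    fix a b assume ab: "a \<in> verts G" "b \<in> verts G"
    have inj: "inj_on (label G) (verts G)" using lab by (simp add: bij_betw_def)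
    have pos: "label G a \<ge> 1" "label G b \<ge> 1"
      using bij_betwE[OF lab] ab by auto
    have "adjacent_labels G (label G a) (label G b) \<longleftrightarrow> {a, b} \<in> edges G"
      using ab inj_on_eq_iff[OF inj] by (auto simp: adjacent_labels_def)
    moreover have "label G a - 1 = label G b - 1 \<longleftrightarrow> a = b"
      using pos inj_on_eq_iff[OF inj] ab by (auto simp: eq_diff_iff)
    ultimately show "M (label G a - 1) (label G b - 1) = char_entry G a b"
      using pos by (simp add: M_def char_entry_def arc_sign_def less_diff_iff)
  qed
  finally show ?thesis .
qed

text \<open>An injection into a set of the same finite size is onto, so the relabellings below need no
  explicit inverse.\<close>

lemma bij_betw_atLeastAtMost_cardI:
  assumes "finite V" and "inj_on l V" and "\<And>w. w \<in> V \<Longrightarrow> 1 \<le> l w \<and> l w \<le> card V"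
  shows "bij_betw l V {1..card V}"
proof -
  have "l ` V = {1..card V}"
    by (rule card_subset_eq) (use assms in \<open>auto simp: card_image\<close>)
  with assms(2) show ?thesis by (simp add: bij_betw_def)
qed

section \<open>Deletion and promotion\<close>

context linearly_ordered_graph
begin

lemma label_inj: "inj_on (label G) (verts G)"
  using label_bij by (simp add: bij_betw_def)

lemma label_range: "w \<in> verts G \<Longrightarrow> 1 \<le> label G w \<and> label G w \<le> card (verts G)"
  using bij_betwE[OF label_bij] by auto

lemma skew_char_poly: "skew_char_poly G = set_det (verts G) (char_entry G)"
  by (rule skew_char_poly_eq_set_det) (rule finite_verts label_bij)+

text \<open>Decrementing the labels above that of \<open>u\<close> closes a gap that no remaining vertex occupies, so the
  order is unchanged. The next lemmas draw from this that deleting a vertex amounts to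
  restricting the index set of the determinant.\<close>

lemma label_delete_less_iff:
  assumes "u \<in> verts G" "a \<in> verts G - {u}" "b \<in> verts G - {u}"
  shows "label (delete_vertex G u) a < label (delete_vertex G u) b \<longleftrightarrow> label G a < label G b"
proof -
  have "label G a \<noteq> label G u" "label G b \<noteq> label G u"
    using assms inj_on_eq_iff[OF label_inj] by auto
  then show ?thesis by (auto simp: delete_vertex_def)
qed

lemma label_delete_bij:
  assumes u: "u \<in> verts G"
  shows "bij_betw (label (delete_vertex G u)) (verts G - {u}) {1..card (verts G - {u})}"
proof (rule bij_betw_atLeastAtMost_cardI)
  show "finite (verts G - {u})" using finite_verts by simp
  show "inj_on (label (delete_vertex G u)) (verts G - {u})"
  proof (rule inj_onI)
    fix a b assume ab: "a \<in> verts G - {u}" "b \<in> verts G - {u}"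
      and "label (delete_vertex G u) a = label (delete_vertex G u) b"
    then have "label G a = label G b"
      using label_delete_less_iff[OF u, of a b] label_delete_less_iff[OF u, of b a] by auto
    with ab show "a = b" using inj_onD[OF label_inj] by auto
  qed
  fix w assume w: "w \<in> verts G - {u}"
  then have "label G w \<noteq> label G u"
    using u inj_on_eq_iff[OF label_inj] by auto
  then show "1 \<le> label (delete_vertex G u) w \<and> label (delete_vertex G u) w \<le> card (verts G - {u})"
    using label_range[of w] label_range[of u] w u finite_verts
    by (auto simp: delete_vertex_def card_Diff_singleton)
qed

lemma skew_char_poly_delete_vertex:
  assumes u: "u \<in> verts G"
  shows "skew_char_poly (delete_vertex G u) = set_det (verts G - {u}) (char_entry G)"
proof -
  have V: "verts (delete_vertex G u) = verts G - {u}" by (simp add: delete_vertex_def)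
  have "skew_char_poly (delete_vertex G u)
      = set_det (verts G - {u}) (char_entry (delete_vertex G u))"
    unfolding V[symmetric]
    by (rule skew_char_poly_eq_set_det) (use finite_verts label_delete_bij[OF u] in \<open>simp_all add: V\<close>)
  also have "\<dots> = set_det (verts G - {u}) (char_entry G)"
    by (intro set_det_cong char_entry_cong label_delete_less_iff[OF u])
      (auto simp: delete_vertex_def)
  finally show ?thesis .
qed

lemma edges_promote [simp]: "edges (promote G v) = edges G"
  by (simp add: promote_def)

lemma label_promote_less_iff:
  assumes v: "v \<in> verts G" and ab: "a \<in> verts G" "b \<in> verts G"
  shows "label (promote G v) a < label (promote G v) b \<longleftrightarrow>
    b \<noteq> v \<and> (a = v \<or> label G a < label G b)"
proof -
  have "a \<noteq> v \<Longrightarrow> label G a \<noteq> label G v" "b \<noteq> v \<Longrightarrow> label G b \<noteq> label G v"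
    using assms inj_on_eq_iff[OF label_inj] by auto
  then show ?thesis
    using label_range[OF v] label_range[OF ab(1)] label_range[OF ab(2)]
    by (auto simp: promote_def)
qed

lemma skew_char_poly_promote:
  assumes v: "v \<in> verts G"
  shows "skew_char_poly (promote G v) = set_det (verts G) (char_entry (promote G v))"
proof -
  have V: "verts (promote G v) = verts G" by (simp add: promote_def)
  have "bij_betw (label (promote G v)) (verts G) {1..card (verts G)}"
  proof (rule bij_betw_atLeastAtMost_cardI[OF finite_verts])
    show "inj_on (label (promote G v)) (verts G)"
    proof (rule inj_onI)
      fix a b assume ab: "a \<in> verts G" "b \<in> verts G"
        and eq: "label (promote G v) a = label (promote G v) b"
      then show "a = b"
        using label_promote_less_iff[OF v ab] label_promote_less_iff[OF v ab(2) ab(1)]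
          inj_on_eq_iff[OF label_inj ab] by auto
    qed
    fix w assume "w \<in> verts G"
    then show "1 \<le> label (promote G v) w \<and> label (promote G v) w \<le> card (verts G)"
      using label_range[of w] label_range[OF v] by (auto simp: promote_def)
  qed
  with finite_verts V show ?thesis
    using skew_char_poly_eq_set_det[of "promote G v"] by simp
qed

text \<open>Promotion changes the order only in comparisons with \<open>v\<close>, so the block of the other vertices
  can be read off the promoted graph as well. This is the form in which it occurs in a
  coalescence.\<close>

lemma skew_char_poly_delete_vertex_promote:
  assumes v: "v \<in> verts G"
  shows "skew_char_poly (delete_vertex G v) = set_det (verts G - {v}) (char_entry (promote G v))"
  unfolding skew_char_poly_delete_vertex[OF v]
  by (intro set_det_cong char_entry_cong) (auto simp: label_promote_less_iff[OF v])

end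

section \<open>Coalescence\<close>

locale coalescence_pair = G: linearly_ordered_graph G + H: linearly_ordered_graph H
  for G :: "'a lograph" and H :: "'b lograph" +
  fixes u :: 'a and v :: 'b
  assumes u: "u \<in> verts G" and v: "v \<in> verts H"
begin

abbreviation "GH \<equiv> coalescence G u H v"

text \<open>The canonical embedding of \<open>H\<close> into the coalescence.\<close>

definition glue :: "'b \<Rightarrow> 'a + 'b" where
  "glue w = (if w = v then Inl u else Inr w)"

lemma inj_glue: "inj glue"
  by (auto simp: inj_def glue_def split: if_splits)

lemma glue_image_eq_iff: "glue ` e = {glue a, glue b} \<longleftrightarrow> e = {a, b}"
  using inj_image_eq_iff[OF inj_glue, of e "{a, b}"] by simp

lemma edges_coalescence: "edges GH = image Inl ` edges G \<union> image glue ` edges H"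
  by (simp add: coalescence_def glue_def[abs_def])

text \<open>An edge of \<open>H\<close> has two ends, so one of them differs from \<open>v\<close> and is not a vertex of \<open>G\<close> in the
  coalescence; hence gluing adds no edges inside \<open>G\<close>.\<close>

lemma edge_Inl_iff: "{Inl a, Inl b} \<in> edges GH \<longleftrightarrow> {a, b} \<in> edges G"
proof -
  have "glue ` e \<noteq> {Inl a, Inl b}" if "e \<in> edges H" for e
  proof
    assume eq: "glue ` e = {Inl a, Inl b}"
    have "w = v" if "w \<in> e" for w
    proof (rule ccontr)
      assume "w \<noteq> v"
      then have "Inr w \<in> glue ` e" using that by (force simp: glue_def)
      then show False unfolding eq by simp
    qed
    then have "card e \<le> card {v}" by (intro card_mono) auto
    then show False using H.edges_simple[OF \<open>e \<in> edges H\<close>] by simp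
  qed
  moreover have "Inl ` e = {Inl a, Inl b} \<longleftrightarrow> e = {a, b}" for e :: "'a set"
    using inj_image_eq_iff[OF inj_Inl, of e "{a, b}"] by simp
  ultimately show ?thesis
    unfolding edges_coalescence Un_iff image_iff by metis
qed

text \<open>Conversely, an edge of \<open>G\<close> cannot lie inside the copy of \<open>H\<close>, which meets \<open>G\<close> in the single
  vertex \<open>u\<close>.\<close>

lemma edge_glue_iff: "{glue a, glue b} \<in> edges GH \<longleftrightarrow> {a, b} \<in> edges H"
proof -
  have "Inl ` e \<noteq> {glue a, glue b}" if "e \<in> edges G" for e
  proof
    assume eq: "Inl ` e = {glue a, glue b}"
    then have "glue a \<in> range Inl" "glue b \<in> range Inl" by blast+
    then have "glue a = Inl u" "glue b = Inl u" by (auto simp: glue_def split: if_splits)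
    then have "Inl ` e = (Inl ` {u} :: ('a + 'b) set)" unfolding eq by simp
    then have "e = {u}" by (simp only: inj_image_eq_iff[OF inj_Inl])
    then show False using G.edges_simple[OF that] by simp
  qed
  then show ?thesis
    unfolding edges_coalescence Un_iff image_iff by (metis glue_image_eq_iff)
qed

lemma no_edge_across: "a \<noteq> u \<Longrightarrow> {Inl a, Inr b} \<notin> edges GH"
  unfolding edges_coalescence
  by (force simp: glue_def split: if_splits)

lemma label_Inl [simp]: "label GH (Inl a) = label G a"
  by (simp add: coalescence_def)

lemma label_Inr [simp]: "label GH (Inr b) = label (delete_vertex H v) b + card (verts G)"
  by (simp add: coalescence_def)

lemma label_delete_pos: "b \<in> verts H \<Longrightarrow> b \<noteq> v \<Longrightarrow> 1 \<le> label (delete_vertex H v) b"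
  using bij_betwE[OF H.label_delete_bij[OF v]] by auto

text \<open>The source of the promoted graph in the formula: the identified vertex keeps its label from
  \<open>G\<close>, which is at most \<open>card (verts G)\<close>, while all other vertices of \<open>H\<close> are shifted beyond
  that bound.\<close>

lemma label_glue_less_iff:
  assumes "a \<in> verts H" "b \<in> verts H"
  shows "label GH (glue a) < label GH (glue b) \<longleftrightarrow>
    label (promote H v) a < label (promote H v) b"
  using assms H.label_delete_less_iff[OF v, of a b] G.label_range[OF u]
    label_delete_pos[of a] label_delete_pos[of b]
  by (auto simp: H.label_promote_less_iff[OF v] glue_def)

lemma verts_coalescence: "verts GH = Inl ` verts G \<union> Inr ` (verts H - {v})"
  by (simp add: coalescence_def)

lemma skew_char_poly_coalescence: "skew_char_poly GH = set_det (verts GH) (char_entry GH)"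
proof (rule skew_char_poly_eq_set_det)
  show fin: "finite (verts GH)"
    using G.finite_verts H.finite_verts by (simp add: verts_coalescence)
  have card: "card (verts GH) = card (verts G) + card (verts H - {v})"
    using G.finite_verts H.finite_verts
    unfolding verts_coalescence by (subst card_Un_disjoint) (auto simp: card_image)
  note delete = H.label_delete_bij[OF v]
  show "bij_betw (label GH) (verts GH) {1..card (verts GH)}"
  proof (rule bij_betw_atLeastAtMost_cardI[OF fin])
    show "inj_on (label GH) (verts GH)"
    proof (rule inj_onI)
      fix x y assume "x \<in> verts GH" "y \<in> verts GH" "label GH x = label GH y"
      then show "x = y"
        using inj_onD[OF G.label_inj] inj_onD[OF bij_betw_imp_inj_on[OF delete]]
          G.label_range label_delete_pos
        by (fastforce simp: verts_coalescence)
    qed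
    fix w assume "w \<in> verts GH"
    then show "1 \<le> label GH w \<and> label GH w \<le> card (verts GH)"
      using bij_betwE[OF delete] unfolding card
      by (auto simp: verts_coalescence trans_le_add1 dest: G.label_range)
  qed
qed

lemma set_det_Inl:
  assumes "A \<subseteq> verts G"
  shows "set_det (Inl ` A) (char_entry GH) = set_det A (char_entry G)"
proof -
  have "set_det (Inl ` A) (char_entry GH)
      = set_det A (\<lambda>a b. char_entry GH (Inl a) (Inl b))"
    by (rule set_det_reindex)
      (use finite_subset[OF assms G.finite_verts] in \<open>auto simp: bij_betw_def\<close>)
  also have "\<dots> = set_det A (char_entry G)"
    by (intro set_det_cong char_entry_cong) (simp_all add: edge_Inl_iff)
  finally show ?thesis .
qed

lemma set_det_glue:
  assumes "B \<subseteq> verts H"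
  shows "set_det (glue ` B) (char_entry GH) = set_det B (char_entry (promote H v))"
proof -
  have "set_det (glue ` B) (char_entry GH)
      = set_det B (\<lambda>a b. char_entry GH (glue a) (glue b))"
    by (rule set_det_reindex)
      (use finite_subset[OF assms H.finite_verts] inj_on_subset[OF inj_glue]
        in \<open>auto simp: bij_betw_def\<close>)
  also have "\<dots> = set_det B (char_entry (promote H v))"
    using assms
    by (intro set_det_cong char_entry_cong label_glue_less_iff)
      (auto simp: edge_glue_iff inj_eq[OF inj_glue])
  finally show ?thesis .
qed

end

section \<open>The characteristic polynomial of a coalescence\<close>

theorem theorem10:
  fixes G :: "'a lograph" and H :: "'b lograph" and u :: 'a and v :: 'b
  assumes "linearly_ordered_graph G" and "linearly_ordered_graph H"
    and "u \<in> verts G" and "v \<in> verts H"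
  shows "skew_char_poly (coalescence G u H v) =
           skew_char_poly G * skew_char_poly (delete_vertex H v)
         + skew_char_poly (delete_vertex G u) * skew_char_poly (promote H v)
         - [:0, 1:] * skew_char_poly (delete_vertex G u) * skew_char_poly (delete_vertex H v)"
proof -
  interpret coalescence_pair G H u v
    using assms by (simp add: coalescence_pair_def coalescence_pair_axioms_def)
  define A :: "('a + 'b) set" where "A = Inl ` (verts G - {u})"
  define B :: "('a + 'b) set" where "B = glue ` (verts H - {v})"
  let ?F = "char_entry (coalescence G u H v)"
  \<comment> \<open>\<open>glue\<close> suits the comparison of blocks, \<open>Inr\<close> the description of the vertex set.\<close>
  have B: "B = Inr ` (verts H - {v})"
    unfolding B_def by (rule image_cong) (auto simp: glue_def)
  have cA: "insert (Inl u) A = Inl ` verts G"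
    using u by (auto simp: A_def)
  have "glue v = Inl u" by (simp add: glue_def)
  then have cB: "insert (Inl u) B = glue ` verts H"
    using v unfolding B_def by (metis image_insert insert_Diff)
  have "verts (coalescence G u H v) = insert (Inl u) (A \<union> B)"
    using cA by (auto simp: verts_coalescence B)
  then have "skew_char_poly (coalescence G u H v) = set_det (insert (Inl u) (A \<union> B)) ?F"
    by (simp add: skew_char_poly_coalescence)
  also have "\<dots> = set_det (insert (Inl u) A) ?F * set_det B ?F
      + set_det A ?F * set_det (insert (Inl u) B) ?F - ?F (Inl u) (Inl u) * set_det A ?F * set_det B ?F"
  proof (rule set_det_cut_vertex)
    show "?F a b = 0" "?F b a = 0" if "a \<in> A" "b \<in> B" for a b
      using that no_edge_across
      by (auto simp: A_def B insert_commute intro!: char_entry_nonadjacent)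
  qed (use G.finite_verts H.finite_verts in \<open>auto simp: A_def B\<close>)
  also have "set_det (insert (Inl u) A) ?F = skew_char_poly G"
    by (simp add: cA set_det_Inl G.skew_char_poly)
  also have "set_det A ?F = skew_char_poly (delete_vertex G u)"
    by (simp add: A_def set_det_Inl G.skew_char_poly_delete_vertex[OF u])
  also have "set_det (insert (Inl u) B) ?F = skew_char_poly (promote H v)"
    by (simp add: cB set_det_glue H.skew_char_poly_promote[OF v])
  also have "set_det B ?F = skew_char_poly (delete_vertex H v)"
    by (simp add: B_def set_det_glue H.skew_char_poly_delete_vertex_promote[OF v])
  also have "?F (Inl u) (Inl u) = [:0, 1:]"
    by (rule char_entry_diagonal)
  finally show ?thesis .
qed

end
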